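(* For sufficiently large $n$, $$l_{n+1}-l_n=O\left(\sqrt{l_n\log l_n}\right),$$ or equivalently $$l_{n+1}-l_n=O\left(\sqrt n\,\log n\right).$$ That is, there exist constants $C>0$ and $n_0$ such that $l_{n+1}-l_n\le C\sqrt{l_n\log l_n}$ for all integers $n\ge n_0$, and likewise there exist constants $C'>0$ and $n_0'$ such that $l_{n+1}-l_n\le C'\sqrt n\log n$ for all integers $n\ge n_0'$.
   Context: Lucky numbers: let $A_0=\mathbb N=\{1,2,3,\dots\}$. Remove every second element of $A_0$ to get $A_1=\{1,3,5,7,\dots\}$. Take the next remaining number, $3$, and remove every third element of $A_1$ (in increasing order) to get $A_2=\{1,3,7,9,13,\dots\}$. Take the next remaining number, $7$, and remove every seventh element of $A_2$ to get $A_3$, and so on. The set of lucky numbers is $A_\infty=\bigcap_i A_i=\{1,3,7,9,13,15,21,25,31,33,\dots\}$. For $n\ge2$, $l_n$ denotes the $n$th lucky number ($l_2=3$, $l_3=7$, $l_4=9,\dots$), and by convention $l_1=2$. $\log$ is the natural logarithm. *)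

theory Defs
  imports Complex_Main "HOL-Library.Infinite_Set"
begin

text \<open>The rank of \<open>x \<in> A\<close> (counted from 1) is \<open>card {y \<in> A. y \<le> x}\<close>.\<close>

definition remove_every :: "nat \<Rightarrow> nat set \<Rightarrow> nat set" where
  "remove_every s A = {x \<in> A. \<not> s dvd card {y \<in> A. y \<le> x}}"

text \<open>
  The state after \<open>i\<close> rounds is \<open>(A\<^sub>i, s)\<close>, where \<open>s\<close> is the number used in the next round.
  The sieving numbers are 2, 3, 7, 9, \<open>\<dots>\<close>: the first one is 2, although 2 is itself
  removed, and each later one is the next number remaining after its predecessor.
\<close>

primrec lucky_state :: "nat \<Rightarrow> nat set \<times> nat" where
  "lucky_state 0 = ({1..}, 2)"
| "lucky_state (Suc i) =
    (let (A, s) = lucky_state i; A' = remove_every s A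
     in (A', LEAST m. m \<in> A' \<and> s < m))"

definition lucky_sieve :: "nat \<Rightarrow> nat set" where
  "lucky_sieve i = fst (lucky_state i)"

definition lucky_numbers :: "nat set" where
  "lucky_numbers = (\<Inter>i. lucky_sieve i)"

text \<open>
  \<^const>\<open>enumerate\<close> counts from 0. By convention the first term is 2 (not the lucky number 1);
  the value at 0 is irrelevant.
\<close>

definition lucky :: "nat \<Rightarrow> nat" where
  "lucky n = (if n = 1 then 2 else enumerate lucky_numbers (n - 1))"

end

theory Submission
  imports Defs "HOL-Real_Asymp.Real_Asymp"
begin

text \<open>
  Write \<open>s\<^sub>0 = 2, s\<^sub>1 = 3, s\<^sub>2 = 7, \<dots>\<close> for the sieving numbers, so that \<open>l\<^sub>n = s\<^bsub>n-1\<^esub>\<close>, and let \<open>a\<^sub>i\<close> be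
  the rank of a lucky number \<open>s\<^sub>n\<close> in \<open>A\<^sub>i\<close>. Running the sieve backwards from \<open>a\<^bsub>n+1\<^esub> = n + 1\<close> to
  \<open>a\<^sub>0 = s\<^sub>n\<close>, the rank obeys \<open>a\<^sub>i = a\<^bsub>i+1\<^esub> + \<lfloor>(a\<^bsub>i+1\<^esub> - 1) / (s\<^sub>i - 1)\<rfloor>\<close>. With
  \<open>P\<^sub>k = \<Prod>i<k. s\<^sub>i / (s\<^sub>i - 1)\<close> this shows that \<open>s\<^sub>n\<close> is of order \<open>n P\<^sub>n\<close>, and since
  \<open>P\<^bsub>n+1\<^esub> - P\<^sub>n = P\<^sub>n / (s\<^sub>n - 1)\<close> is of order \<open>1 / n\<close>, \<open>P\<^sub>n\<close> is of order \<open>log n\<close>.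

  The difference of the ranks of two consecutive lucky numbers is followed backwards as well,
  starting from 1. While \<open>i \<ge> \<surd>n\<close>, it grows only when a multiple of \<open>s\<^sub>i - 1\<close> separates the two
  ranks; as \<open>s\<^sub>i\<close> decreases and the ranks increase, this happens at most once for every value of
  the quotient, so that the difference is at most the quotient plus one, which is \<open>O(\<surd>n)\<close>. The
  remaining \<open>\<surd>n\<close> rounds multiply the difference by \<open>P = O(log n)\<close>, with a rounding error of at
  most \<open>1\<close> per round, which gives \<open>O(\<surd>n log n)\<close>.
\<close>

subsection \<open>Ranks in sets of natural numbers\<close>

definition rank :: "nat set \<Rightarrow> nat \<Rightarrow> nat" where
  "rank A x = card {y \<in> A. y \<le> x}"

lemma rank_0: "rank A 0 = of_bool (0 \<in> A)"
proof -
  have "{y \<in> A. y \<le> 0} = (if 0 \<in> A then {0} else {})" by auto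
  then show ?thesis by (simp add: rank_def)
qed

lemma rank_Suc: "rank A (Suc x) = rank A x + of_bool (Suc x \<in> A)"
proof -
  have "{y \<in> A. y \<le> Suc x} = (if Suc x \<in> A then insert (Suc x) else id) {y \<in> A. y \<le> x}"
    by (auto simp: le_Suc_eq)
  then show ?thesis by (simp add: rank_def)
qed

lemma rank_pos:
  assumes "x \<in> A"
  shows "0 < rank A x"
  using assms by (auto simp: rank_def card_gt_0_iff)

lemma finite_if_rank_bounded:
  assumes "\<And>x. rank A x \<le> c"
  shows "finite A"
proof (rule ccontr)
  assume "infinite A"
  then obtain F where F: "F \<subseteq> A" "finite F" "card F = Suc c"
    using infinite_arbitrarily_large by blast
  then have "card F \<le> rank A (Max F)"
    unfolding rank_def by (intro card_mono) auto
  with assms[of "Max F"] F(3) show False by simp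
qed

lemma
  fixes A :: "nat set"
  assumes "infinite A"
  shows Least_greater_mem: "(LEAST m. m \<in> A \<and> x < m) \<in> A"
    and less_Least_greater: "x < (LEAST m. m \<in> A \<and> x < m)"
proof -
  obtain m where "m \<in> A \<and> x < m"
    using assms infinite_nat_iff_unbounded by blast
  then have "(LEAST m. m \<in> A \<and> x < m) \<in> A \<and> x < (LEAST m. m \<in> A \<and> x < m)"
    by (rule LeastI)
  then show "(LEAST m. m \<in> A \<and> x < m) \<in> A" "x < (LEAST m. m \<in> A \<and> x < m)"
    by simp_all
qed

lemma rank_Least_greater:
  assumes "infinite A"
  shows "rank A (LEAST m. m \<in> A \<and> x < m) = Suc (rank A x)"
proof -
  let ?t = "LEAST m. m \<in> A \<and> x < m"
  have "y \<le> x" if "y \<in> A" "y < ?t" for y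
    using that not_less_Least[of y "\<lambda>m. m \<in> A \<and> x < m"] by auto
  then have "{y \<in> A. y \<le> ?t} = insert ?t {y \<in> A. y \<le> x}"
    using Least_greater_mem[OF assms, of x] less_Least_greater[OF assms, of x] by force
  then show ?thesis
    using less_Least_greater[OF assms, of x] by (simp add: rank_def)
qed

subsection \<open>Removing every \<open>s\<close>-th element\<close>

lemma mem_remove_every: "x \<in> remove_every s A \<longleftrightarrow> x \<in> A \<and> \<not> s dvd rank A x"
  by (simp add: remove_every_def rank_def)

lemma rank_remove_every: "rank (remove_every s A) x = rank A x - rank A x div s"
proof (induction x)
  case 0
  have "Suc 0 div s = of_bool (s = 1)"
    by (cases "s \<le> 1") (auto simp: le_Suc_eq)
  then show ?case by (auto simp: rank_0 mem_remove_every)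
next
  case (Suc x)
  have "rank A x div s \<le> rank A x" by (rule div_le_dividend)
  with Suc.IH show ?case
    by (auto simp: rank_Suc mem_remove_every div_Suc dvd_eq_mod_eq_0)
qed

lemma infinite_remove_every:
  assumes "infinite A" "2 \<le> s"
  shows "infinite (remove_every s A)"
proof
  assume "finite (remove_every s A)"
  then have bound: "rank (remove_every s A) x \<le> card (remove_every s A)" for x
    unfolding rank_def by (intro card_mono) auto
  have "rank A x \<le> 2 * card (remove_every s A)" for x
  proof -
    have "rank A x div s \<le> rank A x div 2"
      using assms(2) by (simp add: div_le_mono2)
    with bound[of x] show ?thesis
      unfolding rank_remove_every by linarith
  qed
  then have "finite A" by (rule finite_if_rank_bounded)
  with assms(1) show False by simp
qed

text \<open>Here \<open>g + 1\<close> is the sieving number.\<close>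

definition rank_before :: "nat \<Rightarrow> nat \<Rightarrow> nat" where
  "rank_before g a = a + (a - 1) div g"

lemma rank_eq_rank_before:
  assumes "x \<in> remove_every s A"
  shows "rank A x = rank_before (s - 1) (rank (remove_every s A) x)"
proof (cases s)
  case 0
  then show ?thesis by (simp add: rank_before_def rank_remove_every)
next
  case (Suc g)
  define q t where "q = rank A x div s" and "t = rank A x mod s"
  have rank: "rank A x = q * g + q + t" and "t < Suc g"
    using div_mult_mod_eq[of "rank A x" s] by (simp_all add: q_def t_def Suc)
  have "0 < t"
    using assms by (simp add: mem_remove_every t_def dvd_eq_mod_eq_0)
  have "rank (remove_every s A) x = rank A x - q"
    by (simp add: rank_remove_every q_def)
  then have "rank (remove_every s A) x = q * g + t"
    by (simp add: rank)
  moreover have "(q * g + t - 1) div g = q"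
    using \<open>0 < t\<close> \<open>t < Suc g\<close> by (cases t) auto
  ultimately show ?thesis by (simp add: rank_before_def rank Suc)
qed

lemma rank_div_eq:
  assumes "x \<in> remove_every s A"
  shows "rank A x div s = (rank (remove_every s A) x - 1) div (s - 1)"
proof -
  have "rank A x div s \<le> rank A x" by (rule div_le_dividend)
  moreover have "rank A x = rank (remove_every s A) x + (rank (remove_every s A) x - 1) div (s - 1)"
    using rank_eq_rank_before[OF assms] by (simp add: rank_before_def)
  ultimately show ?thesis using rank_remove_every[of s A x] by linarith
qed

lemma rank_before_le: "real (rank_before g a) \<le> (1 + 1 / real g) * real a"
proof -
  have "real ((a - 1) div g) \<le> real (a - 1) / real g" by (rule of_nat_div_le_of_nat)
  also have "\<dots> \<le> real a / real g" by (intro divide_right_mono) auto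
  finally show ?thesis by (simp add: rank_before_def distrib_right)
qed

lemma rank_before_ge:
  assumes "0 < g"
  shows "(1 + 1 / real g) * real a \<le> real (rank_before g a) + 1"
proof -
  have "a \<le> (a - 1) div g * g + g"
    using div_mult_mod_eq[of "a - 1" g] mod_less_divisor[OF assms, of "a - 1"] by linarith
  then have "real a \<le> (real ((a - 1) div g) + 1) * real g"
    by (metis of_nat_le_iff of_nat_mult of_nat_add distrib_right mult_1 of_nat_1)
  then have "real a / real g \<le> real ((a - 1) div g) + 1"
    using assms by (simp add: pos_divide_le_eq)
  then show ?thesis by (simp add: rank_before_def distrib_right)
qed

subsection \<open>The rounds of the lucky sieve\<close>

definition sieve_number :: "nat \<Rightarrow> nat" where
  "sieve_number i = snd (lucky_state i)"

lemma lucky_sieve_0: "lucky_sieve 0 = {1..}"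
  by (simp add: lucky_sieve_def)

lemma sieve_number_0: "sieve_number 0 = 2"
  by (simp add: sieve_number_def)

lemma lucky_sieve_Suc: "lucky_sieve (Suc i) = remove_every (sieve_number i) (lucky_sieve i)"
  by (simp add: lucky_sieve_def sieve_number_def Let_def split: prod.split)

lemma sieve_number_Suc:
  "sieve_number (Suc i) = (LEAST m. m \<in> lucky_sieve (Suc i) \<and> sieve_number i < m)"
  by (simp add: lucky_sieve_def sieve_number_def Let_def split: prod.split)

lemma rank_lucky_sieve_0: "rank (lucky_sieve 0) x = x"
  by (induction x) (simp_all add: rank_0 rank_Suc lucky_sieve_0)

lemma rank_lucky_sieve_Suc:
  "rank (lucky_sieve (Suc i)) x = rank (lucky_sieve i) x - rank (lucky_sieve i) x div sieve_number i"
  by (simp add: lucky_sieve_Suc rank_remove_every)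

lemma infinite_lucky_sieve: "infinite (lucky_sieve i)"
  and sieve_number_ge: "i + 2 \<le> sieve_number i"
proof (induction i)
  case 0
  {
    case 1
    show ?case by (simp add: lucky_sieve_0 infinite_Ici)
  next
    case 2
    show ?case by (simp add: sieve_number_0)
  }
next
  case (Suc i)
  then have inf: "infinite (lucky_sieve (Suc i))"
    by (simp add: lucky_sieve_Suc infinite_remove_every)
  {
    case 1
    show ?case by (rule inf)
  next
    case 2
    have "sieve_number i < sieve_number (Suc i)"
      unfolding sieve_number_Suc by (rule less_Least_greater[OF inf])
    with Suc show ?case by simp
  }
qed

lemma sieve_number_Suc_mem: "sieve_number (Suc i) \<in> lucky_sieve (Suc i)"
  unfolding sieve_number_Suc by (rule Least_greater_mem[OF infinite_lucky_sieve])

lemma strict_mono_sieve_number: "strict_mono sieve_number"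
  unfolding strict_mono_Suc_iff sieve_number_Suc
  using less_Least_greater[OF infinite_lucky_sieve] by blast

lemma lucky_sieve_antimono: "i \<le> k \<Longrightarrow> lucky_sieve k \<subseteq> lucky_sieve i"
  by (rule lift_Suc_antimono_le) (auto simp: lucky_sieve_Suc mem_remove_every)

lemma rank_lucky_sieve_antimono: "i \<le> k \<Longrightarrow> rank (lucky_sieve k) x \<le> rank (lucky_sieve i) x"
  by (rule lift_Suc_antimono_le[of "\<lambda>i. rank (lucky_sieve i) x"]) (simp_all add: rank_lucky_sieve_Suc)

lemma rank_lucky_sieve_stable:
  assumes "rank (lucky_sieve i) x \<le> Suc i" "i \<le> k"
  shows "rank (lucky_sieve k) x = rank (lucky_sieve i) x"
  using assms(2)
proof (induction k rule: dec_induct)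
  case (step k)
  then have "rank (lucky_sieve k) x < sieve_number k"
    using assms(1) sieve_number_ge[of k] by linarith
  with step.IH show ?case by (simp add: rank_lucky_sieve_Suc)
qed simp

lemma mem_lucky_numbersI:
  assumes "x \<in> lucky_sieve i" "rank (lucky_sieve i) x \<le> Suc i"
  shows "x \<in> lucky_numbers"
proof -
  have "x \<in> lucky_sieve k" if "i \<le> k" for k
    using that
  proof (induction k rule: dec_induct)
    case (step k)
    have "rank (lucky_sieve k) x < sieve_number k"
      using rank_lucky_sieve_stable[OF assms(2), of k] assms(2) sieve_number_ge[of k] step.hyps
      by linarith
    with step.IH show ?case
      using rank_pos[OF step.IH] by (simp add: lucky_sieve_Suc mem_remove_every nat_dvd_not_less)
  qed (rule assms(1))
  then have "x \<in> lucky_sieve k" for k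
    using lucky_sieve_antimono[of k "max i k"] by auto
  then show ?thesis by (simp add: lucky_numbers_def)
qed

lemma lucky_numbers_subset: "lucky_numbers \<subseteq> lucky_sieve i"
  by (auto simp: lucky_numbers_def)

lemma rank_lucky_sieve_eq_rank_before:
  assumes "x \<in> lucky_numbers"
  shows "rank (lucky_sieve i) x = rank_before (sieve_number i - 1) (rank (lucky_sieve (Suc i)) x)"
  unfolding lucky_sieve_Suc
  using assms lucky_numbers_subset[of "Suc i"]
  by (intro rank_eq_rank_before) (auto simp: lucky_sieve_Suc)

lemma rank_sieve_number_Suc:
  "rank (lucky_sieve (Suc i)) (sieve_number (Suc i)) = Suc (rank (lucky_sieve (Suc i)) (sieve_number i))"
  unfolding sieve_number_Suc by (rule rank_Least_greater[OF infinite_lucky_sieve])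

lemma rank_sieve_number:
  assumes "i < k"
  shows "rank (lucky_sieve k) (sieve_number i) = Suc i"
  using assms
proof (induction i arbitrary: k)
  case 0
  have "rank (lucky_sieve (Suc 0)) (sieve_number 0) = 1"
    by (simp add: rank_lucky_sieve_Suc rank_lucky_sieve_0 sieve_number_0)
  with 0 show ?case using rank_lucky_sieve_stable[of "Suc 0" "sieve_number 0" k] by simp
next
  case (Suc i)
  have "rank (lucky_sieve (Suc i)) (sieve_number (Suc i)) = Suc (Suc i)"
    by (simp add: rank_sieve_number_Suc Suc.IH)
  with Suc.prems show ?case
    using rank_lucky_sieve_stable[of "Suc i" "sieve_number (Suc i)" k] by simp
qed

lemma rank_sieve_number_ge: "Suc n \<le> rank (lucky_sieve i) (sieve_number n)"
  using rank_lucky_sieve_antimono[of i "max i (Suc n)" "sieve_number n"]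
    rank_sieve_number[of n "max i (Suc n)"] by simp

subsection \<open>Lucky numbers as sieving numbers\<close>

lemma one_mem_lucky_numbers: "1 \<in> lucky_numbers"
  by (rule mem_lucky_numbersI[of _ 0]) (simp add: lucky_sieve_0, simp add: rank_lucky_sieve_0)

lemma sieve_number_mem_lucky_numbers:
  assumes "1 \<le> n"
  shows "sieve_number n \<in> lucky_numbers"
proof -
  obtain i where "n = Suc i" using assms by (cases n) auto
  then show ?thesis
    using mem_lucky_numbersI[OF sieve_number_Suc_mem[of i]]
    by (simp add: rank_sieve_number_Suc rank_sieve_number)
qed

lemma infinite_lucky_numbers: "infinite lucky_numbers"
proof (rule infinite_super)
  show "sieve_number ` {1..} \<subseteq> lucky_numbers"
    using sieve_number_mem_lucky_numbers by auto
  show "infinite (sieve_number ` {1..})"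
    using strict_mono_sieve_number
    by (simp add: finite_image_iff strict_mono_imp_inj_on infinite_Ici inj_on_subset)
qed

lemma Least_lucky_number_greater:
  "(LEAST m. m \<in> lucky_numbers \<and> sieve_number n < m) = sieve_number (Suc n)"
proof (rule Least_equality)
  show "sieve_number (Suc n) \<in> lucky_numbers \<and> sieve_number n < sieve_number (Suc n)"
    using sieve_number_mem_lucky_numbers strict_mono_sieve_number by (simp add: strict_mono_less)
  show "sieve_number (Suc n) \<le> m" if "m \<in> lucky_numbers \<and> sieve_number n < m" for m
    unfolding sieve_number_Suc using that lucky_numbers_subset by (intro Least_le) auto
qed

lemma enumerate_lucky_numbers: "enumerate lucky_numbers (Suc n) = sieve_number (Suc n)"
proof (induction n)
  case 0
  have odd: "odd m" if "m \<in> lucky_numbers" for m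
  proof -
    have "m \<in> lucky_sieve (Suc 0)" using that lucky_numbers_subset by blast
    then show ?thesis
      by (simp add: lucky_sieve_Suc mem_remove_every rank_lucky_sieve_0 sieve_number_0)
  qed
  have "(LEAST m. m \<in> lucky_numbers) = 1"
    using one_mem_lucky_numbers odd by (intro Least_equality) (auto intro: Suc_leI odd_pos)
  moreover have "m \<in> lucky_numbers \<and> 1 < m \<longleftrightarrow> m \<in> lucky_numbers \<and> sieve_number 0 < m" for m
    using odd[of m] by (cases "m = 2") (auto simp: sieve_number_0)
  ultimately show ?case
    by (simp only: enumerate_Suc''[OF infinite_lucky_numbers] enumerate_0 Least_lucky_number_greater)
next
  case (Suc n)
  then show ?case
    by (simp only: enumerate_Suc''[OF infinite_lucky_numbers, of "Suc n"] Least_lucky_number_greater)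
qed

lemma lucky_Suc: "lucky (Suc n) = sieve_number n"
  by (cases n) (simp_all add: lucky_def sieve_number_0 enumerate_lucky_numbers)

subsection \<open>Growth of the sieving numbers\<close>

lemma prod_mult_mono_backward_recurrence:
  fixes u r :: "nat \<Rightarrow> real"
  assumes "\<And>i. 1 \<le> r i" "\<And>i. u i \<le> r i * u (Suc i) + e" "0 \<le> e" "i \<le> k"
  shows "(\<Prod>j<i. r j) * (u i + e * real i) \<le> (\<Prod>j<k. r j) * (u k + e * real k)"
proof -
  define P where "P = (\<lambda>i. \<Prod>j<i. r j)"
  have "P i * (u i + e * real i) \<le> P (Suc i) * (u (Suc i) + e * real (Suc i))" for i
  proof -
    have "1 \<le> P i" unfolding P_def using assms(1) by (intro prod_ge_1) auto
    then have "P i * (u i + e * real i) \<le> P i * (r i * u (Suc i) + e + e * real i)"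
      using assms(2)[of i] by (intro mult_left_mono) auto
    also have "\<dots> = P (Suc i) * u (Suc i) + P i * (1 * (e + e * real i))"
      by (simp add: P_def algebra_simps)
    also have "\<dots> \<le> P (Suc i) * u (Suc i) + P i * (r i * (e + e * real i))"
      using assms(1,3) \<open>1 \<le> P i\<close> by (intro add_left_mono mult_left_mono mult_right_mono) auto
    also have "\<dots> = P (Suc i) * (u (Suc i) + e * real (Suc i))"
      by (simp add: P_def algebra_simps)
    finally show ?thesis .
  qed
  then have "P i * (u i + e * real i) \<le> P k * (u k + e * real k)"
    using assms(4) by (rule lift_Suc_mono_le[of "\<lambda>i. P i * (u i + e * real i)"])
  then show ?thesis by (simp add: P_def)
qed

definition sieve_product :: "nat \<Rightarrow> real" where
  "sieve_product k = (\<Prod>i<k. 1 + 1 / real (sieve_number i - 1))"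

lemma sieve_product_0: "sieve_product 0 = 1"
  by (simp add: sieve_product_def)

lemma sieve_product_Suc:
  "sieve_product (Suc k) = sieve_product k + sieve_product k / real (sieve_number k - 1)"
  by (simp add: sieve_product_def distrib_left)

lemma sieve_product_ge_1: "1 \<le> sieve_product k"
  unfolding sieve_product_def by (intro prod_ge_1) simp

lemma sieve_product_mono: "i \<le> j \<Longrightarrow> sieve_product i \<le> sieve_product j"
proof (rule lift_Suc_mono_le)
  show "sieve_product k \<le> sieve_product (Suc k)" for k
    using sieve_product_ge_1[of k] by (simp add: sieve_product_Suc)
qed

lemma sieve_number_minus_1_pos: "0 < sieve_number i - 1"
  using sieve_number_ge[of i] by simp

lemma sieve_product_mult_rank_mono:
  assumes "x \<in> lucky_numbers" "i \<le> k"
  shows "sieve_product i * real (rank (lucky_sieve i) x) \<le> sieve_product k * real (rank (lucky_sieve k) x)"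
proof -
  let ?a = "\<lambda>i. real (rank (lucky_sieve i) x)"
  have "?a i \<le> (1 + 1 / real (sieve_number i - 1)) * ?a (Suc i) + 0" for i
    using rank_before_le[of "sieve_number i - 1"] rank_lucky_sieve_eq_rank_before[OF assms(1), of i]
    by simp
  from prod_mult_mono_backward_recurrence[of _ ?a, OF _ this _ assms(2)] show ?thesis
    by (simp add: sieve_product_def)
qed

lemma sieve_product_mult_rank_le:
  assumes "x \<in> lucky_numbers"
  shows "sieve_product i * (real (rank (lucky_sieve i) x) - real i) \<le> real x"
proof -
  let ?u = "\<lambda>i. - real (rank (lucky_sieve i) x)"
  have "?u i \<le> (1 + 1 / real (sieve_number i - 1)) * ?u (Suc i) + 1" for i
    using rank_before_ge[OF sieve_number_minus_1_pos, of i "rank (lucky_sieve (Suc i)) x"]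
      rank_lucky_sieve_eq_rank_before[OF assms, of i]
    by simp
  from prod_mult_mono_backward_recurrence[of _ ?u, OF _ this _ zero_le, of i]
  have "- real x \<le> sieve_product i * (?u i + real i)"
    by (simp add: sieve_product_def rank_lucky_sieve_0)
  then show ?thesis by (simp add: algebra_simps)
qed

lemma lucky_number_diff_le:
  assumes "x \<in> lucky_numbers" "y \<in> lucky_numbers"
  shows "real y - real x
    \<le> sieve_product i * (real (rank (lucky_sieve i) y) - real (rank (lucky_sieve i) x) + real i)"
proof -
  let ?d = "\<lambda>i. real (rank (lucky_sieve i) y) - real (rank (lucky_sieve i) x)"
  have "?d i \<le> (1 + 1 / real (sieve_number i - 1)) * ?d (Suc i) + 1" for i
    using rank_before_le[of "sieve_number i - 1" "rank (lucky_sieve (Suc i)) y"]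
      rank_before_ge[OF sieve_number_minus_1_pos, of i "rank (lucky_sieve (Suc i)) x"]
      rank_lucky_sieve_eq_rank_before[OF assms(1), of i] rank_lucky_sieve_eq_rank_before[OF assms(2), of i]
    by (simp add: right_diff_distrib)
  from prod_mult_mono_backward_recurrence[of _ ?d, OF _ this _ zero_le, of i] show ?thesis
    by (simp add: sieve_product_def rank_lucky_sieve_0)
qed

lemma sieve_number_minus_1_le: "real (sieve_number n - 1) \<le> (real n + 1) * sieve_product n"
proof (cases "n = 0")
  case True
  then show ?thesis by (simp add: sieve_number_0 sieve_product_0)
next
  case False
  define g where "g = real (sieve_number n - 1)"
  have g: "0 < g" "real (sieve_number n) = g + 1"
    using sieve_number_ge[of n] by (simp_all add: g_def)
  have "sieve_product (Suc n) = sieve_product n + sieve_product n / g"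
    by (simp only: sieve_product_Suc g_def)
  with g(1) have g_mult_product: "g * sieve_product (Suc n) = sieve_product n * (g + 1)"
    by (simp add: distrib_left)
  have "g + 1 \<le> sieve_product (Suc n) * (real n + 1)"
    using sieve_product_mult_rank_mono[OF sieve_number_mem_lucky_numbers, of n 0 "Suc n"] False g(2)
    by (simp add: sieve_product_0 rank_lucky_sieve_0 rank_sieve_number add_ac)
  then have "g * (g + 1) \<le> g * (sieve_product (Suc n) * (real n + 1))"
    using g(1) by (intro mult_left_mono) auto
  also have "\<dots> = (real n + 1) * sieve_product n * (g + 1)"
    by (simp only: mult.assoc[symmetric] g_mult_product) (simp only: mult_ac)
  finally have "g \<le> (real n + 1) * sieve_product n"
    by (rule mult_right_le_imp_le) (use g(1) in simp)
  then show ?thesis by (simp only: g_def)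
qed

lemma sieve_product_ratio_le:
  assumes "m \<le> n"
  shows "sieve_product n * (real m + 1) \<le> sieve_product m * (real n + 1)"
  using assms
proof (induction n rule: dec_induct)
  case (step n)
  have "1 / real (sieve_number n - 1) \<le> 1 / (real n + 1)"
    using sieve_number_ge[of n] by (intro divide_left_mono) auto
  then have "sieve_product n * (1 / real (sieve_number n - 1)) \<le> sieve_product n * (1 / (real n + 1))"
    using sieve_product_ge_1[of n] by (intro mult_left_mono) auto
  then have "sieve_product (Suc n) \<le> sieve_product n * (1 + 1 / (real n + 1))"
    by (simp add: sieve_product_Suc distrib_left)
  then have "sieve_product (Suc n) * (real m + 1)
      \<le> sieve_product n * (1 + 1 / (real n + 1)) * (real m + 1)"
    by (rule mult_right_mono) simp
  also have "\<dots> = (sieve_product n * (real m + 1)) * (1 + 1 / (real n + 1))"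
    by (simp add: mult_ac)
  also have "\<dots> \<le> (sieve_product m * (real n + 1)) * (1 + 1 / (real n + 1))"
    by (intro mult_right_mono step.IH) auto
  also have "\<dots> = sieve_product m * (real (Suc n) + 1)"
    by (simp add: field_simps)
  finally show ?case .
qed simp

lemma sieve_product_le_double_half: "sieve_product n \<le> 2 * sieve_product (n div 2)"
proof -
  define m where "m = n div 2"
  then have m: "m \<le> n" "real n + 1 \<le> 2 * (real m + 1)" by auto
  then have "sieve_product m * (real n + 1) \<le> sieve_product m * (2 * (real m + 1))"
    using sieve_product_ge_1[of m] by (intro mult_left_mono) auto
  with sieve_product_ratio_le[OF m(1)]
  have "sieve_product n * (real m + 1) \<le> 2 * sieve_product m * (real m + 1)"
    by linarith
  then have "sieve_product n \<le> 2 * sieve_product m"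
    by (rule mult_right_le_imp_le) simp
  then show ?thesis by (simp add: m_def)
qed

text \<open>
  Only the first \<open>n / 2\<close> rounds are counted: their rounding errors lower the rank by at most
  \<open>n / 2\<close>, and they already give at least half of the product.
\<close>

lemma sieve_number_minus_1_ge: "(real n + 1) * sieve_product n / 8 \<le> real (sieve_number n - 1)"
proof (cases "n = 0")
  case True
  then show ?thesis by (simp add: sieve_number_0 sieve_product_0)
next
  case False
  define m where "m = n div 2"
  have m: "sieve_product n \<le> 2 * sieve_product m" "real n + 1 \<le> 2 * (real n + 1 - real m)"
    using sieve_product_le_double_half[of n] by (auto simp: m_def)
  have "(real n + 1) * sieve_product n / 8 \<le> (real n + 1) * (2 * sieve_product m) / 8"
    using m(1) by (intro divide_right_mono mult_left_mono) auto
  also have "\<dots> = sieve_product m * ((real n + 1) / 2) / 2"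
    by simp
  also have "\<dots> \<le> sieve_product m * (real (rank (lucky_sieve m) (sieve_number n)) - real m) / 2"
  proof -
    have "real n + 1 \<le> real (rank (lucky_sieve m) (sieve_number n))"
      using rank_sieve_number_ge[of n m] by (simp flip: of_nat_Suc)
    with m(2) have "(real n + 1) / 2 \<le> real (rank (lucky_sieve m) (sieve_number n)) - real m"
      by (simp add: field_simps)
    then show ?thesis
      using sieve_product_ge_1[of m] by (intro divide_right_mono mult_left_mono) auto
  qed
  also have "\<dots> \<le> real (sieve_number n) / 2"
    using sieve_product_mult_rank_le[OF sieve_number_mem_lucky_numbers] False by simp
  also have "\<dots> \<le> real (sieve_number n - 1)"
    using sieve_number_ge[of n] by linarith
  finally show ?thesis .
qed

lemma sieve_product_increment_ge: "sieve_product n + 1 / (real n + 1) \<le> sieve_product (Suc n)"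
proof -
  define g where "g = real (sieve_number n - 1)"
  have "0 < g" "g \<le> (real n + 1) * sieve_product n"
    using sieve_number_minus_1_pos sieve_number_minus_1_le by (simp_all only: g_def of_nat_0_less_iff)
  then have "1 / (real n + 1) \<le> sieve_product n / g" by (simp add: field_simps)
  then show ?thesis by (simp add: sieve_product_Suc g_def)
qed

lemma sieve_product_increment_le: "sieve_product (Suc n) \<le> sieve_product n + 8 / (real n + 1)"
proof -
  define g where "g = real (sieve_number n - 1)"
  have "0 < g" "(real n + 1) * sieve_product n / 8 \<le> g"
    using sieve_number_minus_1_pos sieve_number_minus_1_ge by (simp_all only: g_def of_nat_0_less_iff)
  then have "sieve_product n / g \<le> 8 / (real n + 1)" by (simp add: field_simps)
  then show ?thesis by (simp add: sieve_product_Suc g_def)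
qed

lemma ln_le_sieve_product: "ln (real n + 1) \<le> sieve_product n"
proof (induction n)
  case (Suc n)
  have "ln (real n + 2) - ln (real n + 1) \<le> 1 / (real n + 1)"
    using ln_diff_le[of "real n + 2" "real n + 1"] by simp
  with Suc sieve_product_increment_ge[of n] show ?case by (simp add: add_ac)
qed (simp add: sieve_product_0)

lemma sieve_product_Suc_le_ln: "sieve_product (Suc n) \<le> 2 + 8 * ln (real n + 1)"
proof (induction n)
  case 0
  show ?case by (simp add: sieve_product_Suc sieve_product_0 sieve_number_0)
next
  case (Suc n)
  have "ln (real n + 1) - ln (real n + 2) \<le> - 1 / (real n + 2)"
    using ln_diff_le[of "real n + 1" "real n + 2"] by simp
  with Suc sieve_product_increment_le[of "Suc n"] show ?case by (simp add: add_ac)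
qed

subsection \<open>Rank differences while the quotient is small\<close>

text \<open>
  Here \<open>a \<le> b\<close> are the ranks of two consecutive lucky numbers and \<open>g\<close> is the sieving number
  minus 1. The second alternative describes the rounds after the one in which the multiple
  \<open>((b - 1) div g) * g\<close> has separated the ranks; the remainder is then so large that this
  cannot happen again for the same quotient.
\<close>

definition gap_controlled :: "nat \<Rightarrow> nat \<Rightarrow> nat \<Rightarrow> bool" where
  "gap_controlled a b g \<longleftrightarrow> b \<le> a + (b - 1) div g \<or>
     b \<le> a + (b - 1) div g + 1 \<and> 2 * ((b - 1) div g) \<le> (b - 1) mod g"

lemma gap_controlled_if_le_Suc: "b \<le> Suc a \<Longrightarrow> gap_controlled a b g"
  by (cases "(b - 1) div g") (auto simp: gap_controlled_def)

lemma gap_controlled_imp_le: "gap_controlled a b g \<Longrightarrow> b \<le> a + (b - 1) div g + 1"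
  by (auto simp: gap_controlled_def)

lemma rank_before_gap_le:
  assumes "gap_controlled a b g" "(b - 1) div g \<le> g"
  shows "rank_before g b \<le> rank_before g a + (b - 1) div g + 1"
proof (cases "(b - 1) div g")
  case 0
  then show ?thesis
    using gap_controlled_imp_le[OF assms(1)] by (simp add: rank_before_def)
next
  case (Suc i)
  then have "0 < g" by (cases g) auto
  define t where "t = (b - 1) mod g"
  have "0 < b" using Suc by (cases b) auto
  with Suc have b: "b = Suc i * g + t + 1"
    using div_mult_mod_eq[of "b - 1" g] by (simp add: t_def)
  from assms(1) consider "b \<le> a + Suc i" | "b \<le> a + Suc i + 1" "2 * Suc i \<le> t"
    unfolding gap_controlled_def Suc t_def by blast
  then show ?thesis
  proof cases
    case 1
    then have "i * g \<le> a - 1"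
      using b assms(2) unfolding Suc mult_Suc by linarith
    then have "i \<le> (a - 1) div g"
      using \<open>0 < g\<close> by (simp add: less_eq_div_iff_mult_less_eq)
    with 1 Suc show ?thesis by (simp add: rank_before_def)
  next
    case 2
    then have "Suc i * g \<le> a - 1" using b by simp
    then have "Suc i \<le> (a - 1) div g"
      using \<open>0 < g\<close> by (simp add: less_eq_div_iff_mult_less_eq)
    with 2 Suc show ?thesis by (simp add: rank_before_def)
  qed
qed

lemma rank_before_quotient_cases [consumes 2]:
  fixes b g g' :: nat
  assumes "0 < g'" "g' < g"
  defines "q \<equiv> (b - 1) div g" and "b' \<equiv> rank_before g b"
  obtains (greater) "q < (b' - 1) div g'"
    | (equal) "(b' - 1) div g' = q" "2 * q \<le> (b' - 1) mod g'"
proof -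
  have "q * g' + q \<le> q * g"
    using mult_le_mono2[of "Suc g'" g q] assms(2) by simp
  moreover have "q * g \<le> b - 1" by (simp add: q_def)
  moreover have "b' - 1 = b - 1 + q"
    by (cases b) (simp_all add: b'_def rank_before_def q_def)
  ultimately have b': "q * g' + 2 * q \<le> b' - 1" by linarith
  then have "q \<le> (b' - 1) div g'"
    using assms(1) by (simp add: less_eq_div_iff_mult_less_eq)
  then consider "q < (b' - 1) div g'" | "(b' - 1) div g' = q" by linarith
  then show thesis
  proof cases
    case 2
    then have "2 * q \<le> (b' - 1) mod g'"
      using b' div_mult_mod_eq[of "b' - 1" g'] by simp
    with 2 show thesis by (rule equal)
  qed (rule greater)
qed

lemma gap_controlled_rank_before:
  assumes "gap_controlled a b g" "(b - 1) div g \<le> g" "0 < g'" "g' < g"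
  shows "gap_controlled (rank_before g a) (rank_before g b) g'"
  using assms(3,4)
proof (cases rule: rank_before_quotient_cases[where b = b])
  case greater
  with rank_before_gap_le[OF assms(1,2)] show ?thesis
    unfolding gap_controlled_def by linarith
next
  case equal
  with rank_before_gap_le[OF assms(1,2)] show ?thesis
    by (simp add: gap_controlled_def)
qed

lemma gap_controlled_backward:
  fixes a b g :: "nat \<Rightarrow> nat"
  assumes a: "\<And>i. a i = rank_before (g i) (a (Suc i))"
    and b: "\<And>i. b i = rank_before (g i) (b (Suc i))"
    and g: "strict_mono g" "\<And>i. 0 < g i"
    and start: "gap_controlled (a (Suc k)) (b (Suc k)) (g k)"
    and "m \<le> k" "(b (Suc m) - 1) div g m \<le> g m"
  shows "gap_controlled (a (Suc m)) (b (Suc m)) (g m)"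
  using assms(6,7)
proof (induction m rule: inc_induct)
  case base
  show ?case by (rule start)
next
  case (step m)
  have "g m < g (Suc m)" using g(1) by (simp add: strict_mono_less)
  have "b (Suc (Suc m)) \<le> b (Suc m)" by (simp add: b[of "Suc m"] rank_before_def)
  then have "(b (Suc (Suc m)) - 1) div g (Suc m) \<le> (b (Suc m) - 1) div g m"
    using g(2) \<open>g m < g (Suc m)\<close> by (intro order.trans[OF div_le_mono div_le_mono2]) auto
  with step.prems \<open>g m < g (Suc m)\<close> have small: "(b (Suc (Suc m)) - 1) div g (Suc m) \<le> g (Suc m)"
    by linarith
  show ?case
    unfolding a[of "Suc m"] b[of "Suc m"]
    using step.IH[OF small] small g(2) \<open>g m < g (Suc m)\<close> by (rule gap_controlled_rank_before)
qed

lemma rank_gap_le: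
  fixes m n
  defines "q \<equiv> rank (lucky_sieve m) (sieve_number (Suc n)) div sieve_number m"
  assumes "1 \<le> n" "m \<le> n" "q < sieve_number m"
  shows "rank (lucky_sieve (Suc m)) (sieve_number (Suc n))
    \<le> rank (lucky_sieve (Suc m)) (sieve_number n) + q + 1"
proof -
  let ?rank = "\<lambda>n i. rank (lucky_sieve i) (sieve_number n)"
  have mem: "sieve_number n \<in> lucky_numbers" "sieve_number (Suc n) \<in> lucky_numbers"
    using assms(2) by (simp_all add: sieve_number_mem_lucky_numbers)
  have q: "q = (?rank (Suc n) (Suc m) - 1) div (sieve_number m - 1)"
    using mem(2) lucky_numbers_subset[of "Suc m"] rank_div_eq unfolding q_def lucky_sieve_Suc by blast
  have "strict_mono (\<lambda>i. sieve_number i - 1)"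
  proof (rule strict_monoI)
    show "sieve_number i - 1 < sieve_number j - 1" if "i < j" for i j
      using strict_monoD[OF strict_mono_sieve_number that] sieve_number_ge[of i] by linarith
  qed
  moreover have "gap_controlled (?rank n (Suc n)) (?rank (Suc n) (Suc n)) (sieve_number n - 1)"
    by (rule gap_controlled_if_le_Suc) (simp add: rank_sieve_number_Suc)
  ultimately have "gap_controlled (?rank n (Suc m)) (?rank (Suc n) (Suc m)) (sieve_number m - 1)"
    using assms(3,4) q
    by (intro gap_controlled_backward[of "?rank n" "\<lambda>i. sieve_number i - 1" "?rank (Suc n)" n m]
          rank_lucky_sieve_eq_rank_before mem sieve_number_minus_1_pos) auto
  from gap_controlled_imp_le[OF this] show ?thesis by (simp add: q)
qed

subsection \<open>Gaps between lucky numbers\<close>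

lemma sieve_number_gap_le:
  fixes m n
  defines "q \<equiv> rank (lucky_sieve m) (sieve_number (Suc n)) div sieve_number m"
  assumes "1 \<le> n" "m \<le> n" "q < sieve_number m"
  shows "real (sieve_number (Suc n)) - real (sieve_number n)
    \<le> sieve_product (Suc m) * (real q + real m + 2)"
proof -
  let ?rank = "\<lambda>n. rank (lucky_sieve (Suc m)) (sieve_number n)"
  have "?rank (Suc n) \<le> ?rank n + q + 1"
    unfolding q_def using assms by (intro rank_gap_le) auto
  then have "sieve_product (Suc m) * (real (?rank (Suc n)) - real (?rank n) + real (Suc m))
      \<le> sieve_product (Suc m) * (real q + real m + 2)"
    using sieve_product_ge_1[of "Suc m"] by (intro mult_left_mono) auto
  with assms(2) show ?thesis
    using lucky_number_diff_le[of "sieve_number n" "sieve_number (Suc n)" "Suc m"]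
    by (simp add: sieve_number_mem_lucky_numbers)
qed

lemma rank_div_sieve_number_le:
  assumes "1 \<le> n" "m \<le> Suc n"
  shows "real (rank (lucky_sieve m) (sieve_number n) div sieve_number m) * ((real m + 1) * (sieve_product m)\<^sup>2)
    \<le> 8 * ((real n + 1) * sieve_product (Suc n))"
proof -
  let ?a = "rank (lucky_sieve m) (sieve_number n)" and ?s = "sieve_number m" and ?P = "sieve_product m"
  have "real (?a div ?s) * ((real m + 1) * ?P\<^sup>2) = 8 * (?P * (real (?a div ?s) * ((real m + 1) * ?P / 8)))"
    by (simp add: power2_eq_square)
  also have "\<dots> \<le> 8 * (?P * real ?a)"
  proof -
    have "(real m + 1) * ?P / 8 \<le> real ?s"
      using sieve_number_minus_1_ge[of m] by linarith
    then have "real (?a div ?s) * ((real m + 1) * ?P / 8) \<le> real (?a div ?s) * real ?s"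
      by (rule mult_left_mono) simp
    also have "\<dots> \<le> real ?a"
      unfolding of_nat_mult[symmetric] of_nat_le_iff by simp
    finally show ?thesis
      using sieve_product_ge_1[of m] by (intro mult_left_mono) auto
  qed
  also have "\<dots> \<le> 8 * (sieve_product (Suc n) * (real n + 1))"
    using sieve_product_mult_rank_mono[OF sieve_number_mem_lucky_numbers[OF assms(1)] assms(2)]
    by (simp add: rank_sieve_number add_ac)
  finally show ?thesis by (simp add: mult_ac)
qed

lemma eventually_rank_div_sieve_number_le:
  "\<forall>\<^sub>F n in sequentially. \<forall>m\<le>n. sqrt (real n) < real m + 1 \<longrightarrow>
     real (rank (lucky_sieve m) (sieve_number (Suc n)) div sieve_number m) \<le> sqrt (real n) - 1"
proof -
  have "\<forall>\<^sub>F n :: nat in sequentially. 8 * ((real n + 2) * (2 + 8 * ln (real n + 2)))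
      \<le> (sqrt (real n) - 1) * (sqrt (real n) * (ln (real n) / 2)\<^sup>2)"
    by real_asymp
  then show ?thesis
    using eventually_ge_at_top[of 2]
  proof eventually_elim
    case (elim n)
    show ?case
    proof (intro allI impI)
      fix m assume m: "m \<le> n" "sqrt (real n) < real m + 1"
      let ?q = "rank (lucky_sieve m) (sieve_number (Suc n)) div sieve_number m"
      have "ln (real n) / 2 = ln (sqrt (real n))" using elim(2) by (simp add: ln_sqrt)
      also have "\<dots> \<le> ln (real m + 1)" using m elim(2) by (intro ln_mono) auto
      also have "\<dots> \<le> sieve_product m" by (rule ln_le_sieve_product)
      finally have P: "ln (real n) / 2 \<le> sieve_product m" .
      have "0 < ln (real n)" using elim(2) by simp
      then have "real ?q * (sqrt (real n) * (ln (real n) / 2)\<^sup>2)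
          \<le> real ?q * ((real m + 1) * (sieve_product m)\<^sup>2)"
        using m(2) P by (intro mult_left_mono mult_mono power_mono) auto
      also have "\<dots> \<le> 8 * ((real n + 2) * sieve_product (Suc (Suc n)))"
        using rank_div_sieve_number_le[of "Suc n" m] m(1) by (simp add: add_ac)
      also have "\<dots> \<le> 8 * ((real n + 2) * (2 + 8 * ln (real n + 2)))"
        using sieve_product_Suc_le_ln[of "Suc n"] by (intro mult_left_mono) (auto simp: add_ac)
      also note elim(1)
      finally show "real ?q \<le> sqrt (real n) - 1"
        using \<open>0 < ln (real n)\<close> elim(2) by (simp add: mult_le_cancel_right)
    qed
  qed
qed

lemma eventually_lucky_gap_le:
  "\<forall>\<^sub>F n in sequentially. real (lucky (n + 1)) - real (lucky n) \<le> 20 * (sqrt (real n) * ln (real n))"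
proof -
  have "\<forall>\<^sub>F n :: nat in sequentially. (2 + 8 * ln (real n + 1)) * (2 * sqrt (real n) + 1)
      \<le> 20 * (sqrt (real n + 1) * ln (real n + 1))"
    by real_asymp
  with eventually_rank_div_sieve_number_le eventually_ge_at_top[of 1]
  have "\<forall>\<^sub>F n in sequentially. real (sieve_number (Suc n)) - real (sieve_number n)
      \<le> 20 * (sqrt (real n + 1) * ln (real n + 1))"
  proof eventually_elim
    case (elim n)
    define m where "m = nat \<lfloor>sqrt (real n)\<rfloor>"
    define q where "q = rank (lucky_sieve m) (sieve_number (Suc n)) div sieve_number m"
    have m: "real m \<le> sqrt (real n)" "sqrt (real n) < real m + 1"
      by (auto simp: m_def)
    have "sqrt (real n) \<le> real n" using elim(2) by (simp add: real_le_lsqrt power2_eq_square)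
    with m(1) have "m \<le> n" by linarith
    with elim(1) m(2) have q: "real q \<le> sqrt (real n) - 1" by (simp add: q_def)
    with m(2) sieve_number_ge[of m] have "q < sieve_number m" by linarith
    then have "real (sieve_number (Suc n)) - real (sieve_number n)
        \<le> sieve_product (Suc m) * (real q + real m + 2)"
      unfolding q_def using elim(2) \<open>m \<le> n\<close> by (intro sieve_number_gap_le)
    also have "\<dots> \<le> sieve_product (Suc n) * (2 * sqrt (real n) + 1)"
      using q m(1) \<open>m \<le> n\<close> sieve_product_ge_1[of "Suc n"] by (intro mult_mono sieve_product_mono) auto
    also have "\<dots> \<le> (2 + 8 * ln (real n + 1)) * (2 * sqrt (real n) + 1)"
      by (intro mult_right_mono sieve_product_Suc_le_ln) auto
    also note elim(3)
    finally show ?case .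
  qed
  then have "\<forall>\<^sub>F n in sequentially. real (lucky (Suc n + 1)) - real (lucky (Suc n))
      \<le> 20 * (sqrt (real (Suc n)) * ln (real (Suc n)))"
    by (simp add: lucky_Suc add.commute)
  then show ?thesis by (subst (asm) eventually_sequentially_Suc)
qed

lemma sqrt_mult_ln_le_lucky:
  assumes "1 \<le> n"
  shows "sqrt (real n) * ln (real n) \<le> 3 * sqrt (real (lucky n) * ln (real (lucky n)))"
proof -
  obtain k where k: "n = Suc k" using assms by (cases n) auto
  have "real n * ln (real n) / 8 \<le> real n * sieve_product k / 8"
    using ln_le_sieve_product[of k] by (simp add: k add_ac mult_left_mono)
  also have "\<dots> \<le> real (lucky n)"
    using sieve_number_minus_1_ge[of k] by (simp add: k lucky_Suc add_ac)
  finally have "real n * ln (real n) / 8 \<le> real (lucky n)" .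
  moreover have "ln (real n) \<le> ln (real (lucky n))"
    using sieve_number_ge[of k] by (intro ln_mono) (auto simp: k lucky_Suc)
  ultimately have "real n * ln (real n) / 8 * ln (real n) \<le> real (lucky n) * ln (real (lucky n))"
    using assms by (intro mult_mono) auto
  moreover have "(sqrt (real n) * ln (real n))\<^sup>2 = 8 * (real n * ln (real n) / 8 * ln (real n))"
    by (simp add: power_mult_distrib power2_eq_square)
  moreover have "0 \<le> real n * ln (real n) / 8 * ln (real n)" using assms by simp
  ultimately have "(sqrt (real n) * ln (real n))\<^sup>2 \<le> 9 * (real (lucky n) * ln (real (lucky n)))"
    by linarith
  then have "sqrt (real n) * ln (real n) \<le> sqrt (9 * (real (lucky n) * ln (real (lucky n))))"
    by (rule real_le_rsqrt)
  then show ?thesis by (simp add: real_sqrt_mult)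
qed

theorem theorem5p1:
  shows "(\<exists>C::real. C > 0 \<and> (\<exists>n0::nat. \<forall>n\<ge>n0.
            real (lucky (n + 1)) - real (lucky n)
              \<le> C * sqrt (real (lucky n) * ln (real (lucky n)))))
       \<and> (\<exists>C'::real. C' > 0 \<and> (\<exists>n0'::nat. \<forall>n\<ge>n0'.
            real (lucky (n + 1)) - real (lucky n)
              \<le> C' * (sqrt (real n) * ln (real n))))"
proof -
  have "\<forall>\<^sub>F n in sequentially.
      real (lucky (n + 1)) - real (lucky n) \<le> 60 * sqrt (real (lucky n) * ln (real (lucky n)))"
    using eventually_lucky_gap_le eventually_ge_at_top[of 1]
  proof eventually_elim
    case (elim n)
    with sqrt_mult_ln_le_lucky[of n] show ?case by linarith
  qed
  then have "\<exists>C>0. \<exists>n0. \<forall>n\<ge>n0.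
      real (lucky (n + 1)) - real (lucky n) \<le> C * sqrt (real (lucky n) * ln (real (lucky n)))"
    unfolding eventually_sequentially by (intro exI[of _ 60]) simp
  moreover have "\<exists>C'>0. \<exists>n0'. \<forall>n\<ge>n0'.
      real (lucky (n + 1)) - real (lucky n) \<le> C' * (sqrt (real n) * ln (real n))"
    using eventually_lucky_gap_le unfolding eventually_sequentially by (intro exI[of _ 20]) simp
  ultimately show ?thesis by (rule conjI)
qed

end
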